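(* Let $G$ be a graph and let $m\in\mathbb N$ with $\operatorname{Z}(G)\le m\le|V(G)|$. Then $$\operatorname{ppt}(G,m)\le\left\lceil\frac{\operatorname{pt}(G,m)}{2}\right\rceil.$$
   Context: All graphs are finite, simple and undirected. Each vertex is blue or white; blue vertices stay blue. Standard zero forcing rule: a blue vertex $u$ with exactly one white neighbor $v$ can force $v$ to become blue. For an initial blue set $B$, put $B^{[0]}=B$ and let $B^{[k]}$ be the union of $B^{[k-1]}$ and the set of all vertices that can be forced by some vertex when exactly $B^{[k-1]}$ is blue. $B$ is a standard zero forcing set if $B^{[k]}=V(G)$ for some $k$, and the least such $k$ is $\operatorname{pt}(G,B)$. $\operatorname{Z}(G)$ is the minimum size of a standard zero forcing set, and $\operatorname{pt}(G,m)$ is the minimum of $\operatorname{pt}(G,B)$ over standard zero forcing sets with $|B|=m$. Power domination: for an initial blue set $B$, put $P^{[0]}=B$, $P^{[1]}=N_G[B]$ (the closed neighborhood of $B$), and for $k\ge2$ let $P^{[k]}$ be the union of $P^{[k-1]}$ and all vertices that can be forced under the standard rule when exactly $P^{[k-1]}$ is blue. $B$ is a power dominating set if $P^{[k]}=V(G)$ for some $k$; the least such $k$ is $\operatorname{ppt}(G,B)$. $\operatorname{ppt}(G,m)$ is the minimum of $\operatorname{ppt}(G,B)$ over power dominating sets $B$ with $|B|=m$. *)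

theory Defs
  imports Complex_Main "Graph_Theory.Pair_Digraph"
begin

text \<open>
  A finite simple undirected graph is a \<open>pair_graph\<close>: finite, symmetric and loop-free,
  with each edge \<open>uv\<close> represented by both arcs \<open>(u, v)\<close> and \<open>(v, u)\<close>.
  Below, \<open>B\<close> always denotes the set of blue vertices.
\<close>

definition can_force :: "'a pair_pre_digraph \<Rightarrow> 'a set \<Rightarrow> 'a \<Rightarrow> 'a \<Rightarrow> bool" where
  "can_force G B u v \<longleftrightarrow> u \<in> B \<and> {w. (u, w) \<in> parcs G \<and> w \<notin> B} = {v}"

definition force_step :: "'a pair_pre_digraph \<Rightarrow> 'a set \<Rightarrow> 'a set" where
  "force_step G B = B \<union> {v. \<exists>u. can_force G B u v}"

definition closed_nbhd :: "'a pair_pre_digraph \<Rightarrow> 'a set \<Rightarrow> 'a set" where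
  "closed_nbhd G B = B \<union> {v. \<exists>u\<in>B. (u, v) \<in> parcs G}"


primrec zf_blue :: "'a pair_pre_digraph \<Rightarrow> 'a set \<Rightarrow> nat \<Rightarrow> 'a set" where
  "zf_blue G B 0 = B"
| "zf_blue G B (Suc k) = force_step G (zf_blue G B k)"

definition zero_forcing_set :: "'a pair_pre_digraph \<Rightarrow> 'a set \<Rightarrow> bool" where
  "zero_forcing_set G B \<longleftrightarrow> B \<subseteq> pverts G \<and> (\<exists>k. zf_blue G B k = pverts G)"

definition zero_forcing_number :: "'a pair_pre_digraph \<Rightarrow> nat" where
  "zero_forcing_number G = (LEAST n. \<exists>B. zero_forcing_set G B \<and> card B = n)"

definition pt_set :: "'a pair_pre_digraph \<Rightarrow> 'a set \<Rightarrow> nat" where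
  "pt_set G B = (LEAST k. zf_blue G B k = pverts G)"

text \<open>
  The minima \<open>pt\<close> and \<open>ppt\<close> are unspecified when no (zero forcing, respectively power
  dominating) set of size \<open>m\<close> exists.
\<close>

definition pt :: "'a pair_pre_digraph \<Rightarrow> nat \<Rightarrow> nat" where
  "pt G m = (LEAST k. \<exists>B. zero_forcing_set G B \<and> card B = m \<and> pt_set G B = k)"


fun pd_blue :: "'a pair_pre_digraph \<Rightarrow> 'a set \<Rightarrow> nat \<Rightarrow> 'a set" where
  "pd_blue G B 0 = B"
| "pd_blue G B (Suc 0) = closed_nbhd G B"
| "pd_blue G B (Suc (Suc k)) = force_step G (pd_blue G B (Suc k))"

definition power_dominating_set :: "'a pair_pre_digraph \<Rightarrow> 'a set \<Rightarrow> bool" where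
  "power_dominating_set G B \<longleftrightarrow> B \<subseteq> pverts G \<and> (\<exists>k. pd_blue G B k = pverts G)"

definition ppt_set :: "'a pair_pre_digraph \<Rightarrow> 'a set \<Rightarrow> nat" where
  "ppt_set G B = (LEAST k. pd_blue G B k = pverts G)"

definition ppt :: "'a pair_pre_digraph \<Rightarrow> nat \<Rightarrow> nat" where
  "ppt G m = (LEAST k. \<exists>B. power_dominating_set G B \<and> card B = m \<and> ppt_set G B = k)"

end

theory Submission
  imports Defs
begin

text \<open>
  Let \<open>t\<close> be half the propagation time (rounded down) of an optimal zero forcing set \<open>B\<close>, and
  let \<open>M\<close> consist of the vertices that are blue at time \<open>t\<close> but have not yet forced, i.e. of the
  midpoints of the forcing chains. Starting from \<open>M\<close>, the second half of the process is replayed forwards and,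
  simultaneously, the first half is replayed backwards. Edges between vertices blue at time \<open>t\<close>
  and vertices white at time \<open>t\<close> start in \<open>M\<close>, so the two processes interfere only at vertices
  of \<open>M\<close>, all of whose neighbours become blue in the domination step.
\<close>

lemma can_forceD:
  assumes "can_force G S u v"
  shows "u \<in> S" "(u, v) \<in> parcs G" "v \<notin> S" "(u, w) \<in> parcs G \<Longrightarrow> w \<noteq> v \<Longrightarrow> w \<in> S"
  using assms by (auto simp: can_force_def)

text \<open>Covers both cases at once: a blue \<open>v\<close> is kept, and a white \<open>v\<close>
  is the only white neighbour of \<open>u\<close>.\<close>

lemma force_stepI:
  assumes "u \<in> S" "(u, v) \<in> parcs G" "\<And>w. (u, w) \<in> parcs G \<Longrightarrow> w \<noteq> v \<Longrightarrow> w \<in> S"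
  shows "v \<in> force_step G S"
  using assms by (auto simp: force_step_def can_force_def)

text \<open>With more blue vertices, \<open>u\<close> still has no white neighbour other than
  \<open>v\<close>; so it still forces \<open>v\<close>, unless \<open>v\<close> is blue
  already.\<close>

lemma force_step_mono:
  assumes "S \<subseteq> T"
  shows "force_step G S \<subseteq> force_step G T"
proof
  fix v assume "v \<in> force_step G S"
  then consider "v \<in> S" | u where "can_force G S u v"
    by (auto simp: force_step_def)
  then show "v \<in> force_step G T"
  proof cases
    case 1
    with assms show ?thesis by (auto simp: force_step_def)
  next
    case 2
    with assms show ?thesis
      by (intro force_stepI[of u]) (auto dest: can_forceD)
  qed
qed

lemma zf_blue_mono_time: "i \<le> j \<Longrightarrow> zf_blue G B i \<subseteq> zf_blue G B j"
  by (rule lift_Suc_mono_le[of "zf_blue G B"]) (auto simp: force_step_def)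

lemma zf_blue_mono: "B \<subseteq> C \<Longrightarrow> zf_blue G B k \<subseteq> zf_blue G C k"
  by (induction k) (auto dest: force_step_mono)

lemma pd_blue_mono_time: "i \<le> j \<Longrightarrow> pd_blue G B i \<subseteq> pd_blue G B j"
proof (rule lift_Suc_mono_le[of "pd_blue G B"])
  show "pd_blue G B n \<subseteq> pd_blue G B (Suc n)" for n
    by (cases n) (auto simp: force_step_def closed_nbhd_def)
qed

context pair_wf_digraph
begin

lemma force_step_subset_pverts: "S \<subseteq> pverts G \<Longrightarrow> force_step G S \<subseteq> pverts G"
  by (auto simp: force_step_def dest: can_forceD(2) in_arcsD2)

lemma zf_blue_subset_pverts: "B \<subseteq> pverts G \<Longrightarrow> zf_blue G B k \<subseteq> pverts G"
  by (induction k) (auto dest: force_step_subset_pverts)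

lemma pd_blue_subset_pverts: "B \<subseteq> pverts G \<Longrightarrow> pd_blue G B k \<subseteq> pverts G"
proof (induction k)
  case (Suc k)
  then show ?case
    by (cases k) (auto simp: closed_nbhd_def dest: in_arcsD2 subsetD[OF force_step_subset_pverts])
qed simp

lemma zero_forcing_set_superset:
  assumes "zero_forcing_set G B" "B \<subseteq> C" "C \<subseteq> pverts G"
  shows "zero_forcing_set G C"
  using assms zf_blue_mono[OF assms(2), of G] zf_blue_subset_pverts[OF assms(3)]
  unfolding zero_forcing_set_def by (metis subset_antisym)

end

lemma zf_blue_forcer:
  assumes "v \<in> zf_blue G B t" "v \<notin> B"
  shows "\<exists>u j. j < t \<and> can_force G (zf_blue G B j) u v"
  using assms
proof (induction t)
  case (Suc t)
  then show ?case
    by (cases "v \<in> zf_blue G B t") (auto simp: force_step_def intro: less_SucI)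
qed simp

lemma can_force_neighbours_blue:
  assumes "can_force G (zf_blue G B i) u v" "(u, w) \<in> parcs G" "i < j"
  shows "w \<in> zf_blue G B j"
proof -
  have "w \<in> zf_blue G B (Suc i)"
    using assms(1,2) by (cases "w = v") (auto simp: force_step_def dest: can_forceD)
  with zf_blue_mono_time[of "Suc i" j G B] assms(3) show ?thesis by auto
qed

text \<open>After its first force a vertex has no white neighbour left, so both forces happen at the
  same time, when the white neighbour is unique.\<close>

lemma can_force_unique:
  assumes "can_force G (zf_blue G B i) u v" "can_force G (zf_blue G B j) u w"
  shows "v = w"
proof -
  have "i = j"
    using can_force_neighbours_blue[OF assms(1) can_forceD(2)[OF assms(2)], of j]
      can_force_neighbours_blue[OF assms(2) can_forceD(2)[OF assms(1)], of i]
      can_forceD(3)[OF assms(1)] can_forceD(3)[OF assms(2)]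
    by (meson linorder_neqE_nat)
  with assms show ?thesis by (auto simp: can_force_def)
qed

lemma (in pair_graph) midpoint_power_dominating:
  assumes B: "B \<subseteq> pverts G"
    and full: "zf_blue G B (t + n) = pverts G" and "t \<le> n"
  obtains M where "M \<subseteq> pverts G" "card M = card B" "pd_blue G M n = pverts G"
proof -
  let ?Z = "zf_blue G B"
  have "\<forall>v \<in> ?Z t - B. \<exists>u j. j < t \<and> can_force G (?Z j) u v"
    using zf_blue_forcer by fast
  \<comment> \<open>Fixing one forcer \<open>f v\<close> for each vertex coloured by time
    \<open>t\<close> fixes the forcing chains; \<open>M\<close> collects their ends at time
    \<open>t\<close>.\<close>
  then obtain f where f: "\<And>v. v \<in> ?Z t - B \<Longrightarrow> \<exists>j < t. can_force G (?Z j) (f v) v"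
    by metis
  define M where "M = ?Z t - f ` (?Z t - B)"
  let ?P = "pd_blue G M"
  have sym: "(u, v) \<in> parcs G \<Longrightarrow> (v, u) \<in> parcs G" for u v
    using arcs_symmetric by blast
  have MP: "M \<subseteq> ?P k" for k
    using pd_blue_mono_time[of 0 k G M] by simp
  have nbhd: "v \<in> ?P (Suc k)" if "u \<in> M" "(u, v) \<in> parcs G" for u v k
    using that pd_blue_mono_time[of "Suc 0" "Suc k" G M] by (auto simp: closed_nbhd_def)
  have ZtV: "?Z t \<subseteq> pverts G"
    using zf_blue_subset_pverts[OF B] .
  have fZ: "f ` (?Z t - B) \<subseteq> ?Z t"
  proof (rule image_subsetI)
    fix v assume "v \<in> ?Z t - B"
    then obtain j where "j < t" "can_force G (?Z j) (f v) v" using f by blast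
    then show "f v \<in> ?Z t"
      using can_forceD(1) zf_blue_mono_time[of j t G B] by fastforce
  qed
  have cardM: "card M = card B"
  proof -
    have inj: "inj_on f (?Z t - B)"
    proof (rule inj_onI)
      fix v w assume "v \<in> ?Z t - B" "w \<in> ?Z t - B" "f v = f w"
      with f[of v] f[of w] show "v = w" by (auto intro: can_force_unique)
    qed
    have fin: "finite (?Z t)" using finite_subset[OF ZtV pair_finite_verts] .
    have sub: "B \<subseteq> ?Z t" using zf_blue_mono_time[of 0 t G B] by simp
    have "card M = card (?Z t) - card (?Z t - B)"
      unfolding M_def using fZ fin by (simp add: card_Diff_subset finite_subset card_image[OF inj])
    also have "\<dots> = card B"
      using sub fin card_mono[OF fin sub] by (simp add: card_Diff_subset finite_subset)
    finally show ?thesis .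
  qed
  \<comment> \<open>A vertex \<open>f w\<close> has forced before time \<open>t\<close>, hence all
    its neighbours are blue at time \<open>t\<close>.\<close>
  have boundary: "u \<in> M" if "u \<in> ?Z t" "(u, v) \<in> parcs G" "v \<notin> ?Z t" for u v
  proof (rule ccontr)
    assume "u \<notin> M"
    with that(1) obtain w where w: "w \<in> ?Z t - B" "u = f w" by (auto simp: M_def)
    with f obtain j where "j < t" "can_force G (?Z j) u w" by blast
    with that(2,3) show False using can_force_neighbours_blue by metis
  qed
  \<comment> \<open>No step is lost: vertices forcing at time \<open>t\<close> lie in
    \<open>M\<close> by \<open>boundary\<close>, so the domination step does the work of the first
    force.\<close>
  have forward: "?Z (t + Suc k) - ?Z t \<subseteq> ?P (Suc k)" for k
  proof (induction k)
    case 0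
    show ?case
    proof
      fix v assume v: "v \<in> ?Z (t + Suc 0) - ?Z t"
      then obtain u where "can_force G (?Z t) u v"
        by (auto simp: force_step_def)
      then show "v \<in> ?P (Suc 0)"
        using boundary nbhd can_forceD(1-3) by metis
    qed
  next
    case (Suc k)
    show ?case
    proof
      fix v assume v: "v \<in> ?Z (t + Suc (Suc k)) - ?Z t"
      then consider "v \<in> ?Z (t + Suc k)" | u where "can_force G (?Z (t + Suc k)) u v"
        by (auto simp: force_step_def)
      then show "v \<in> ?P (Suc (Suc k))"
      proof cases
        case 1
        with v Suc show ?thesis by (auto simp: force_step_def)
      next
        case 2
        note u = can_forceD[OF 2]
        show ?thesis
        proof (cases "u \<in> ?Z t")
          case True
          with u(2) v boundary nbhd show ?thesis by blast
        next
          case False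
          \<comment> \<open>As \<open>u\<close> is white at time \<open>t\<close>, its neighbours
            that are blue then lie in \<open>M\<close>; the others come from the induction
            hypothesis.\<close>
          have "w \<in> ?P (Suc k)" if w: "(u, w) \<in> parcs G" "w \<noteq> v" for w
          proof (cases "w \<in> ?Z t")
            case True
            with boundary sym w(1) False MP show ?thesis by blast
          qed (use u(4)[OF w] Suc in blast)
          with u(1,2) False Suc show ?thesis
            by (auto intro!: force_stepI[of u])
        qed
      qed
    qed
  qed
  \<comment> \<open>Chains are traversed in reverse, \<open>v\<close> now forcing
    \<open>f v\<close>, latest forces first: forces made at time \<open>t - (k + 1)\<close> or later
    are reversed by step \<open>k + 1\<close>.\<close>
  have backward: "f v \<in> ?P (Suc k)"
    if "v \<in> ?Z t - B" "can_force G (?Z j) (f v) v" "t \<le> j + Suc k" for v j k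
    using that
  proof (induction k arbitrary: v j)
    case 0
    \<comment> \<open>Here \<open>j\<close> is at least \<open>t - 1\<close>. Had \<open>v\<close>
      forced before time \<open>t\<close>, it would already be blue at time \<open>j\<close>, when
      it is about to be forced.\<close>
    have "v \<in> M"
    proof (rule ccontr)
      assume "v \<notin> M"
      then obtain w where w: "w \<in> ?Z t - B" "v = f w"
        using 0 by (auto simp: M_def)
      then obtain s where "s < t" "can_force G (?Z s) v w"
        using f by blast
      then have "v \<in> ?Z j"
        using 0(3) can_forceD(1) zf_blue_mono_time[of s j G B] by fastforce
      with 0(2) show False by (auto dest: can_forceD)
    qed
    with 0 show ?case using nbhd sym can_forceD(2) by metis
  next
    case (Suc k)
    note vj = can_forceD[OF Suc.prems(2)]
    show ?case
    proof (cases "v \<in> M")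
      case True
      with vj(2) nbhd sym show ?thesis by metis
    next
      case False
      then obtain w where w: "w \<in> ?Z t - B" "v = f w"
        using Suc.prems by (auto simp: M_def)
      then obtain s where s: "s < t" "can_force G (?Z s) v w"
        using f by blast
      \<comment> \<open>A vertex forces only after becoming blue, so the force by \<open>v\<close>
        is later than \<open>j\<close> and the induction hypothesis covers it.\<close>
      have "j < s"
        using vj(3) can_forceD(1)[OF s(2)] zf_blue_mono_time[of s j G B] by (meson in_mono not_le)
      then have v: "v \<in> ?P (Suc k)"
        using Suc.IH[of w s] w s(2) Suc.prems(3) by auto
      \<comment> \<open>Outside \<open>M\<close>, \<open>x\<close> has forced some \<open>y\<close>
        different from \<open>v\<close>. At that moment its neighbour \<open>v\<close> had to be
        blue, so this force is also later than \<open>j\<close> and already reversed.\<close>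
      have "x \<in> ?P (Suc k)" if x: "(v, x) \<in> parcs G" "x \<noteq> f v" for x
      proof (cases "x \<in> M")
        case False
        have "x \<in> ?Z t"
          using can_force_neighbours_blue[OF s(2) x(1) s(1)] .
        then obtain y where y: "y \<in> ?Z t - B" "x = f y"
          using False by (auto simp: M_def)
        then obtain r where r: "can_force G (?Z r) x y"
          using f by blast
        have "v \<noteq> y" using x(2) y(2) by blast
        then have "v \<in> ?Z r"
          using can_forceD(4)[OF r] sym[OF x(1)] by blast
        then have "j < r"
          using vj(3) zf_blue_mono_time[of r j G B] by (meson in_mono not_le)
        then show ?thesis
          using Suc.IH[of y r] y r Suc.prems(3) by auto
      qed (use MP in blast)
      with v sym[OF vj(2)] show ?thesis
        by (auto intro!: force_stepI[of v])
    qed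
  qed
  have MV: "M \<subseteq> pverts G" using ZtV M_def by blast
  have "pverts G \<subseteq> ?P n"
  proof (cases n)
    \<comment> \<open>Now \<open>t = 0\<close>, no force has been made, and \<open>M\<close> is
      \<open>B\<close>, which is all of \<open>pverts G\<close>.\<close>
    case 0
    with \<open>t \<le> n\<close> full show ?thesis by (simp add: M_def)
  next
    case (Suc k)
    show ?thesis
    proof
      fix v assume v: "v \<in> pverts G"
      consider "v \<notin> ?Z t" | "v \<in> M" | w where "w \<in> ?Z t - B" "v = f w"
        by (auto simp: M_def)
      then show "v \<in> ?P n"
      proof cases
        case 1
        with v forward[of k] full Suc show ?thesis by auto
      next
        case 2
        with MP show ?thesis by blast
      next
        case 3
        with f[of w] backward[of w _ k] Suc \<open>t \<le> n\<close> show ?thesis by auto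
      qed
    qed
  qed
  with pd_blue_subset_pverts[OF MV] have "?P n = pverts G" by blast
  with that MV cardM show thesis by blast
qed

text \<open>A minimum zero forcing set can be padded to size \<open>m\<close>, since supersets keep
  forcing. This guarantees that the \<open>LEAST\<close> in \<open>pt\<close> is attained.\<close>

lemma (in pair_graph) zero_forcing_set_of_card:
  assumes "zero_forcing_number G \<le> m" "m \<le> card (pverts G)"
  obtains B where "zero_forcing_set G B" "card B = m"
proof -
  have "zero_forcing_set G (pverts G)"
    unfolding zero_forcing_set_def by (auto intro: exI[of _ 0])
  then have "\<exists>B. zero_forcing_set G B \<and> card B = zero_forcing_number G"
    unfolding zero_forcing_number_def
    by (intro LeastI_ex[of "\<lambda>n. \<exists>B. zero_forcing_set G B \<and> card B = n"]) blast
  then obtain B where B: "zero_forcing_set G B" "card B = zero_forcing_number G" by blast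
  then obtain C where "B \<subseteq> C" "C \<subseteq> pverts G" "card C = m"
    using exists_subset_between[of B m "pverts G"] assms by (auto simp: zero_forcing_set_def)
  with zero_forcing_set_superset[OF B(1)] that show thesis by blast
qed

theorem theorem4p14:
  fixes G :: "'a pair_pre_digraph" and m :: nat
  assumes "pair_graph G"
    and "zero_forcing_number G \<le> m"
    and "m \<le> card (pverts G)"
  shows "int (ppt G m) \<le> \<lceil>real (pt G m) / 2\<rceil>"
proof -
  interpret pair_graph G by fact
  have "\<exists>B. zero_forcing_set G B \<and> card B = m \<and> pt_set G B = pt G m"
    unfolding pt_def using zero_forcing_set_of_card[OF assms(2,3)]
    by (intro LeastI_ex[of "\<lambda>k. \<exists>B. zero_forcing_set G B \<and> card B = m \<and> pt_set G B = k"]) blast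
  then obtain B where B: "zero_forcing_set G B" "card B = m" "pt_set G B = pt G m"
    by blast
  have full: "zf_blue G B (pt G m) = pverts G"
    unfolding B(3)[symmetric] pt_set_def
    by (rule LeastI_ex) (use B(1) in \<open>simp add: zero_forcing_set_def\<close>)
  \<comment> \<open>This is half of \<open>pt G m\<close> rounded up; the split time
    \<open>pt G m - n\<close> is the half rounded down, hence at most \<open>n\<close>.\<close>
  define n where "n = (pt G m + 1) div 2"
  obtain M where M: "M \<subseteq> pverts G" "card M = card B" "pd_blue G M n = pverts G"
  proof (rule midpoint_power_dominating)
    show "B \<subseteq> pverts G" using B(1) by (simp add: zero_forcing_set_def)
    show "zf_blue G B ((pt G m - n) + n) = pverts G" using full by (simp add: n_def)
    show "pt G m - n \<le> n" by (simp add: n_def)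
  qed
  have "ppt G m \<le> ppt_set G M"
    unfolding ppt_def using M B(2) by (intro Least_le) (auto simp: power_dominating_set_def)
  also have "\<dots> \<le> n"
    unfolding ppt_set_def using M(3) by (rule Least_le)
  finally have "int (ppt G m) \<le> int n" by simp
  also have "int n \<le> \<lceil>real (pt G m) / 2\<rceil>"
    unfolding n_def by linarith
  finally show ?thesis .
qed

end
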